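(* Let $1<p_1,\dots,p_m<\infty$ and $0<p<\infty$ be such that $\frac1p=\sum_{j=1}^m\frac1{p_j}$. Assume that $\mathcal B$ is a basis in $\mathbf R^n$ and that $\{\Psi_j\}_{j=1}^m$ is a sequence of Young functions, with complementary functions $\bar\Psi_j$, such that the operator $$\mathcal M_{\overrightarrow{\bar\Psi}}^{\mathcal B}(\vec f\,)(x):=\sup_{B\in\mathcal B,\,B\ni x}\ \prod_{j=1}^m\|f_j\|_{\bar\Psi_j,B},\qquad \vec f=(f_1,\dots,f_m),$$ is bounded from $L^{p_1}(\mathbf R^n)\times\cdots\times L^{p_m}(\mathbf R^n)$ to $L^p(\mathbf R^n)$. Let $(\nu,\vec w\,)=(\nu,w_1,\dots,w_m)$ be weights such that $\nu^p$ satisfies condition $(A)$ and $$\sup_{B\in\mathcal B}\left(\frac1{|B|}\int_B\nu(x)^p\,dx\right)^{1/p}\prod_{j=1}^m\|w_j^{-1}\|_{\Psi_j,B}<\infty .$$ Then $\mathcal M_{\mathcal B}$ is bounded from $L^{p_1}(w_1^{p_1})\times\cdots\times L^{p_m}(w_m^{p_m})$ to $L^p(\nu^p)$.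
   Context: A basis $\mathcal B$ in $\mathbf R^n$ is a collection of open sets in $\mathbf R^n$ (non-empty and of finite Lebesgue measure, so that averages make sense). A weight associated with $\mathcal B$ is a non-negative measurable function $w$ on $\mathbf R^n$ with $w(B)=\int_B w\,dx<\infty$ for every $B\in\mathcal B$; we write $w(E)=\int_E w\,dx$. $L^q(w)$ denotes $L^q(\mathbf R^n,w\,dx)$. Define $$\mathcal M_{\mathcal B}(\vec f\,)(x)=\sup_{B\in\mathcal B,\,B\ni x}\ \prod_{j=1}^m\frac1{|B|}\int_B|f_j(y)|\,dy,\qquad M_{\mathcal B}f(x)=\sup_{B\in\mathcal B,\,B\ni x}\frac1{|B|}\int_B|f(y)|\,dy .$$ An $m$-(sub)linear operator $T$ is bounded from $X_1\times\cdots\times X_m$ to $Y$ if $\|T(\vec f\,)\|_Y\le C\prod_{j=1}^m\|f_j\|_{X_j}$ for a constant $C$ independent of $\vec f$. A Young function is a continuous, convex, strictly increasing function $\Phi:[0,\infty)\to[0,\infty)$ with $\Phi(0)=0$ and $\Phi(t)\to\infty$ as $t\to\infty$. Its complementary function is $\bar\Phi(s)=\sup_{t>0}\{st-\Phi(t)\}$, $s\ge0$. For a set $E$ of finite positive measure, the normalized Luxemburg norm is $$\|f\|_{\Phi,E}=\inf\Big\{\lambda>0:\frac1{|E|}\int_E\Phi\Big(\frac{|f(x)|}{\lambda}\Big)dx\le1\Big\},$$ and similarly with $\bar\Phi$ in place of $\Phi$. Condition $(A)$ (relative to $\mathcal B$): a weight $w$ associated with $\mathcal B$ satisfies $(A)$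 if there are constants $0<\lambda<1$ and $0<c(\lambda)<\infty$ such that $$w\big(\{x\in\mathbf R^n: M_{\mathcal B}(\chi_E)(x)>\lambda\}\big)\le c(\lambda)\,w(E)$$ for all measurable sets $E$. *)

theory Defs
  imports "HOL-Analysis.Analysis"
begin

text \<open>
  All measurability and integration is with respect to Lebesgue measure.  Quantities that may be
  infinite (norms, averages, maximal functions, reciprocals of weights) live in \<^typ>\<open>ennreal\<close>,
  with the conventions that the infimum of the empty set is infinite, the supremum of the empty set
  is zero, and \<open>0 * \<infinity> = 0\<close>.
\<close>

definition is_basis :: "(real ^ 'n) set set \<Rightarrow> bool" where
  "is_basis \<B> \<longleftrightarrow> (\<forall>B\<in>\<B>. open B \<and> B \<noteq> {} \<and> emeasure lebesgue B < \<infinity>)"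

definition weight :: "(real ^ 'n) set set \<Rightarrow> (real ^ 'n \<Rightarrow> real) \<Rightarrow> bool" where
  "weight \<B> w \<longleftrightarrow> w \<in> borel_measurable lebesgue \<and> (\<forall>x. 0 \<le> w x) \<and>
     (\<forall>B\<in>\<B>. (\<integral>\<^sup>+x\<in>B. ennreal (w x) \<partial>lebesgue) < \<infinity>)"

text \<open>The measure \<open>w dx\<close>.\<close>

definition weighted :: "(real ^ 'n \<Rightarrow> real) \<Rightarrow> (real ^ 'n) measure" where
  "weighted w = density lebesgue (\<lambda>x. ennreal (w x))"

text \<open>Powers with positive real exponent, extended by \<open>\<infinity>\<close> at \<open>\<infinity>\<close>.\<close>

definition epowr :: "ennreal \<Rightarrow> real \<Rightarrow> ennreal" where
  "epowr u q = (if u = \<infinity> then \<infinity> else ennreal (enn2real u powr q))"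

definition Lp_norm :: "real \<Rightarrow> 'a measure \<Rightarrow> ('a \<Rightarrow> ennreal) \<Rightarrow> ennreal" where
  "Lp_norm q M g = epowr (\<integral>\<^sup>+x. epowr (g x) q \<partial>M) (1 / q)"

definition in_Lp :: "real \<Rightarrow> 'a measure \<Rightarrow> ('a \<Rightarrow> real) \<Rightarrow> bool" where
  "in_Lp q M f \<longleftrightarrow> f \<in> borel_measurable M \<and> Lp_norm q M (\<lambda>x. ennreal \<bar>f x\<bar>) < \<infinity>"

definition average :: "(real ^ 'n) set \<Rightarrow> (real ^ 'n \<Rightarrow> ennreal) \<Rightarrow> ennreal" where
  "average B g = (\<integral>\<^sup>+x\<in>B. g x \<partial>lebesgue) / emeasure lebesgue B"

definition maximal ::
  "(real ^ 'n) set set \<Rightarrow> (real ^ 'n \<Rightarrow> real) \<Rightarrow> real ^ 'n \<Rightarrow> ennreal" where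
  "maximal \<B> f x = (SUP B\<in>{B\<in>\<B>. x \<in> B}. average B (\<lambda>y. ennreal \<bar>f y\<bar>))"

text \<open>An \<open>m\<close>-tuple of functions is a family of which only the members with index in
  \<open>{1..m}\<close> matter.\<close>

definition multi_maximal ::
  "nat \<Rightarrow> (real ^ 'n) set set \<Rightarrow> (nat \<Rightarrow> real ^ 'n \<Rightarrow> real) \<Rightarrow> real ^ 'n \<Rightarrow> ennreal" where
  "multi_maximal m \<B> f x =
     (SUP B\<in>{B\<in>\<B>. x \<in> B}. \<Prod>j=1..m. average B (\<lambda>y. ennreal \<bar>f j y\<bar>))"

text \<open>Only the values of a Young function on \<open>[0,\<infinity>)\<close> matter; they are nonnegative because the
  function vanishes at 0 and increases.\<close>

definition young_function :: "(real \<Rightarrow> real) \<Rightarrow> bool" where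
  "young_function \<Phi> \<longleftrightarrow> continuous_on {0..} \<Phi> \<and> convex_on {0..} \<Phi> \<and> strict_mono_on {0..} \<Phi> \<and>
     \<Phi> 0 = 0 \<and> filterlim \<Phi> at_top at_top"

text \<open>The complementary function can take the value \<open>\<infinity>\<close> (e.g. for \<open>\<Phi> t = t\<close>).  Truncating
  negative terms at 0 does not change the supremum, because \<open>s * t - \<Phi> t\<close> tends to 0 as \<open>t\<close>
  decreases to 0.\<close>

definition complementary :: "(real \<Rightarrow> real) \<Rightarrow> real \<Rightarrow> ennreal" where
  "complementary \<Phi> s = (SUP t\<in>{0<..}. ennreal (s * t - \<Phi> t))"

text \<open>Luxemburg norm of a \<open>[0,\<infinity>]\<close>-valued function, with \<open>\<Phi> \<infinity> = \<infinity>\<close>.  Both \<open>\<Phi>\<close> and its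
  argument may be infinite: complementary functions can be, and so is \<open>1 / w\<close> where \<open>w = 0\<close>.\<close>

definition luxemburg ::
  "(real \<Rightarrow> ennreal) \<Rightarrow> (real ^ 'n) set \<Rightarrow> (real ^ 'n \<Rightarrow> ennreal) \<Rightarrow> ennreal" where
  "luxemburg \<Phi> E g = (INF r\<in>{r::real. 0 < r \<and>
     average E (\<lambda>x. if g x = \<infinity> then \<infinity> else \<Phi> (enn2real (g x) / r)) \<le> 1}. ennreal r)"

definition multi_orlicz_maximal ::
  "nat \<Rightarrow> (real ^ 'n) set set \<Rightarrow> (nat \<Rightarrow> real \<Rightarrow> ennreal) \<Rightarrow>
     (nat \<Rightarrow> real ^ 'n \<Rightarrow> real) \<Rightarrow> real ^ 'n \<Rightarrow> ennreal" where
  "multi_orlicz_maximal m \<B> \<Phi> f x =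
     (SUP B\<in>{B\<in>\<B>. x \<in> B}. \<Prod>j=1..m. luxemburg (\<Phi> j) B (\<lambda>y. ennreal \<bar>f j y\<bar>))"

text \<open>Boundedness of \<open>T\<close> from the product of the spaces \<open>L^(q j) (M j)\<close> to \<open>L^p (N)\<close>.  The functions
  \<open>f j\<close> must have finite norm, since otherwise the right-hand side could be \<open>0 * \<infinity> = 0\<close>.\<close>

definition multi_bounded ::
  "nat \<Rightarrow> (nat \<Rightarrow> real) \<Rightarrow> (nat \<Rightarrow> 'a measure) \<Rightarrow> real \<Rightarrow> 'a measure \<Rightarrow>
     ((nat \<Rightarrow> 'a \<Rightarrow> real) \<Rightarrow> 'a \<Rightarrow> ennreal) \<Rightarrow> bool" where
  "multi_bounded m q M p N T \<longleftrightarrow> (\<exists>C::real. 0 \<le> C \<and>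
     (\<forall>f. (\<forall>j\<in>{1..m}. in_Lp (q j) (M j) (f j)) \<longrightarrow>
       Lp_norm p N (T f) \<le> ennreal C * (\<Prod>j=1..m. Lp_norm (q j) (M j) (\<lambda>x. ennreal \<bar>f j x\<bar>))))"

definition condition_A :: "(real ^ 'n) set set \<Rightarrow> (real ^ 'n \<Rightarrow> real) \<Rightarrow> bool" where
  "condition_A \<B> w \<longleftrightarrow> weight \<B> w \<and> (\<exists>l c::real. 0 < l \<and> l < 1 \<and> 0 < c \<and>
     (\<forall>E\<in>sets lebesgue. emeasure (weighted w) {x. maximal \<B> (indicator E) x > ennreal l}
        \<le> ennreal c * emeasure (weighted w) E))"

end

theory Submission
  imports Defs
begin

text \<open>
  The proof separates the geometry of the basis from the Orlicz norms.

  The geometric part is lemma \<open>maximal_transference\<close>. Suppose that two set functions satisfy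
  \<open>u(B) a(B) \<le> K |B| b(B)\<close> for every \<open>B\<close> in the basis, where the weight \<open>u\<close> satisfies condition (A).
  Then the integral of \<open>x \<mapsto> sup {a(B). x \<in> B}\<close> against \<open>u dx\<close> is at most a constant times \<open>K\<close>
  times the integral of \<open>x \<mapsto> sup {b(B). x \<in> B}\<close> against \<open>dx\<close>. The reason is a greedy selection
  (lemma \<open>scattered_subfamily\<close>): from a finite family one extracts sets that keep a fixed proportion
  of their measure after those selected earlier are removed, while every discarded set is covered, to
  a fraction exceeding the threshold in condition (A), by selected sets with no smaller values of
  \<open>a\<close>. Condition (A) then says that discarding such sets costs only a constant factor in the
  weighted measure of each superlevel set, so the layer-cake formula bounds the left-hand integral,
  up to this factor, by the sum of \<open>u(A) a(A)\<close> over the selected sets. By hypothesis this is at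
  most \<open>K\<close> times the sum of \<open>|A| b(A)\<close>, and the disjoint remainders turn the latter into an
  integral. Finite families suffice by Lindelof's theorem and monotone convergence.

  The theorem takes \<open>u = \<nu>\<^sup>p\<close>, lets \<open>a(B)\<close> be the \<open>p\<close>-th power of the product of the means of
  \<open>|f j|\<close> and \<open>b(B)\<close> that of the product of the norms of \<open>f j * w j\<close> for the complementary Young
  functions. Hoelder's inequality for Luxemburg norms (lemma \<open>orlicz_hoelder\<close>) and the weight
  condition give the comparison of \<open>a\<close> and \<open>b\<close> (lemma \<open>prod_average_le_orlicz\<close>). The supremum of
  \<open>b\<close> is the \<open>p\<close>-th power of the Orlicz maximal function of \<open>(f j * w j)\<close>, which is bounded on
  Lebesgue spaces by assumption, and the unweighted norm of \<open>f j * w j\<close> is the weighted norm of \<open>f j\<close>.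
\<close>

section \<open>Arithmetic of extended nonnegative reals\<close>

lemma epowr_ennreal: "0 \<le> a \<Longrightarrow> epowr (ennreal a) q = ennreal (a powr q)"
  by (simp add: epowr_def)

lemma epowr_mono: "0 \<le> q \<Longrightarrow> a \<le> b \<Longrightarrow> epowr a q \<le> epowr b q"
  unfolding epowr_def
  by (auto simp: top_unique less_top intro!: ennreal_leI powr_mono2 enn2real_mono)

lemma epowr_inverse_exponent: "0 < p \<Longrightarrow> epowr (epowr x p) (1 / p) = x"
  by (cases x) (auto simp: epowr_def powr_powr)

lemma epowr_inverse_exponent': "0 < p \<Longrightarrow> epowr (epowr x (1 / p)) p = x"
  using epowr_inverse_exponent[of "1 / p" x] by simp

text \<open>
  The degenerate products agree: both sides vanish if one factor is \<open>0\<close> and the other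
  \<open>\<infinity>\<close>, since \<open>0 * \<infinity> = 0\<close>.
\<close>

lemma epowr_mult:
  assumes "0 < p" shows "epowr (a * b) p = epowr a p * epowr b p"
proof (cases a; cases b)
  fix r s assume "0 \<le> r" "a = ennreal r" "0 \<le> s" "b = ennreal s"
  then show ?thesis
    by (simp add: epowr_ennreal powr_mult flip: ennreal_mult)
qed (use assms in \<open>auto simp: epowr_def ennreal_mult_top ennreal_top_mult enn2real_eq_0_iff\<close>)

text \<open>
  A power with positive exponent is an increasing bijection of \<open>[0,\<infinity>]\<close>, so it commutes with
  suprema, including the empty one.
\<close>

lemma epowr_SUP:
  assumes "0 < p" shows "epowr (SUP i\<in>I. g i) p = (SUP i\<in>I. epowr (g i) p)"
proof (rule antisym)
  have "g i \<le> epowr (SUP i\<in>I. epowr (g i) p) (1 / p)" if "i \<in> I" for i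
    using epowr_mono[OF _ SUP_upper[OF that, of "\<lambda>i. epowr (g i) p"], of "1 / p"] assms
    by (simp add: epowr_inverse_exponent)
  then have "(SUP i\<in>I. g i) \<le> epowr (SUP i\<in>I. epowr (g i) p) (1 / p)"
    by (rule SUP_least)
  from epowr_mono[OF _ this, of p] show "epowr (SUP i\<in>I. g i) p \<le> (SUP i\<in>I. epowr (g i) p)"
    using assms by (simp add: epowr_inverse_exponent')
  show "(SUP i\<in>I. epowr (g i) p) \<le> epowr (SUP i\<in>I. g i) p"
    using assms by (auto intro!: SUP_least epowr_mono SUP_upper)
qed

lemma borel_measurable_epowr [measurable]:
  assumes [measurable]: "g \<in> borel_measurable M"
  shows "(\<lambda>x. epowr (g x) q) \<in> borel_measurable M"
  unfolding epowr_def by measurable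

lemma less_divide_ennrealI:
  fixes a b x :: ennreal
  assumes "a * b < x" "0 < b" "b < \<infinity>"
  shows "a < x / b"
proof (rule ccontr)
  assume "\<not> a < x / b"
  then have "x / b * b \<le> a * b" by (intro mult_right_mono) auto
  then show False
    using assms by (simp add: ennreal_divide_times)
qed

text \<open>
  The finiteness of the constant is essential: \<open>\<infinity> * r = \<infinity>\<close> for every \<open>r > 0\<close>, but an
  infimum of such \<open>r\<close> can be \<open>0\<close>.
\<close>

lemma le_mult_INF_ennreal:
  assumes "0 < c" "\<And>i. i \<in> I \<Longrightarrow> x \<le> ennreal c * f i"
  shows "x \<le> ennreal c * (INF i\<in>I. f i)"
proof -
  have c: "ennreal c > 0" "ennreal c \<noteq> 0" "ennreal c \<noteq> top" using assms by auto
  have "x / ennreal c \<le> (INF i\<in>I. f i)"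
    using assms(2) c by (intro INF_greatest divide_le_posI_ennreal) auto
  then have "ennreal c * (x / ennreal c) \<le> ennreal c * (INF i\<in>I. f i)" by (rule mult_left_mono) simp
  then show ?thesis using c
    by (simp add: ennreal_times_divide mult.commute[of _ x] mult_divide_eq_ennreal)
qed

section \<open>Averages, Luxemburg norms and the Orlicz form of Hoelder's inequality\<close>

lemma average_mono: "(\<And>x. x \<in> B \<Longrightarrow> g x \<le> h x) \<Longrightarrow> average B g \<le> average B h"
  unfolding average_def
  by (intro divide_right_mono_ennreal nn_integral_mono) (auto simp: indicator_def)

lemma average_add:
  assumes [measurable]: "B \<in> sets lebesgue" "g \<in> borel_measurable lebesgue"
    "h \<in> borel_measurable lebesgue"
  shows "average B (\<lambda>x. g x + h x) = average B g + average B h"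
  unfolding average_def by (simp add: nn_integral_add distrib_right add_divide_distrib_ennreal)

lemma average_cmult:
  assumes [measurable]: "B \<in> sets lebesgue" "g \<in> borel_measurable lebesgue"
  shows "average B (\<lambda>x. c * g x) = c * average B g"
  unfolding average_def by (simp add: nn_integral_cmult mult.assoc ennreal_times_divide)

lemma average_const:
  assumes "B \<in> sets lebesgue" "0 < emeasure lebesgue B" "emeasure lebesgue B < \<infinity>"
  shows "average B (\<lambda>x. c) = c"
  using assms unfolding average_def
  by (simp add: nn_integral_cmult_indicator mult_divide_eq_ennreal less_top)

lemma young_function_nonneg: "young_function \<Phi> \<Longrightarrow> 0 \<le> t \<Longrightarrow> 0 \<le> \<Phi> t"
  unfolding young_function_def
  by (metis atLeast_iff order.refl strict_mono_on_leD)

lemma young_function_pos: "young_function \<Phi> \<Longrightarrow> 0 < t \<Longrightarrow> 0 < \<Phi> t"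
  unfolding young_function_def
  by (metis atLeast_iff order.refl less_imp_le strict_mono_onD)

text \<open>
  By convexity and \<open>\<Phi> 0 = 0\<close>, the slope \<open>\<Phi> t / t\<close> increases with \<open>t\<close>, so it is at least
  \<open>\<Phi> 1\<close> for \<open>t \<ge> 1\<close>.
\<close>

lemma young_function_linear_bound:
  assumes "young_function \<Phi>" "0 \<le> t"
  shows "t \<le> 1 + \<Phi> t / \<Phi> 1"
proof (cases "t \<le> 1")
  case True
  then show ?thesis
    using young_function_nonneg[OF assms] young_function_pos[OF assms(1), of 1]
    by (smt (verit) divide_nonneg_pos)
next
  case False
  have "\<Phi> ((1 - 1 / t) *\<^sub>R 0 + (1 / t) *\<^sub>R t) \<le> (1 - 1 / t) * \<Phi> 0 + (1 / t) * \<Phi> t"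
    using assms False unfolding young_function_def by (intro convex_onD[of "{0..}" \<Phi>]) auto
  then have "\<Phi> 1 \<le> \<Phi> t / t"
    using False assms by (simp add: young_function_def)
  then have "t \<le> \<Phi> t / \<Phi> 1"
    using False young_function_pos[OF assms(1), of 1] by (simp add: field_simps)
  then show ?thesis by simp
qed

lemma young_inequality:
  assumes "young_function \<Phi>" "0 \<le> t"
  shows "ennreal (s * t) \<le> ennreal (\<Phi> t) + complementary \<Phi> s"
proof (cases "t = 0")
  case False
  have "ennreal (s * t) \<le> ennreal (\<Phi> t + max 0 (s * t - \<Phi> t))"
    by (intro ennreal_leI) simp
  also have "\<dots> = ennreal (\<Phi> t) + ennreal (s * t - \<Phi> t)"
    using young_function_nonneg[OF assms]
    by (subst ennreal_plus) (auto simp: max_def ennreal_neg)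
  also have "ennreal (s * t - \<Phi> t) \<le> complementary \<Phi> s"
    unfolding complementary_def using False assms by (intro SUP_upper) auto
  finally show ?thesis by (simp add: add_left_mono)
qed simp

text \<open>
  Nothing is known about \<open>\<Phi>\<close> on the negative axis, so measurability is only available after
  truncating the argument.
\<close>

lemma borel_measurable_young_function:
  assumes "young_function \<Phi>"
  shows "(\<lambda>t. \<Phi> (max 0 t)) \<in> borel_measurable borel"
proof (rule borel_measurable_continuous_onI)
  show "continuous_on UNIV (\<lambda>t. \<Phi> (max 0 t))"
  proof (rule continuous_on_compose2[of "{0..}" \<Phi> UNIV "max 0"])
    show "continuous_on {0..} \<Phi>" using assms by (simp add: young_function_def)
    show "continuous_on UNIV (max (0::real))" by (intro continuous_on_max continuous_on_const continuous_on_id)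
  qed auto
qed

text \<open>
  As a supremum of continuous functions, the complementary function is lower semicontinuous.
\<close>

lemma borel_measurable_complementary [measurable]: "complementary \<Phi> \<in> borel_measurable borel"
proof (rule borel_measurableI_greater)
  fix y :: ennreal
  have "{s. y < complementary \<Phi> s} = (\<Union>t\<in>{0<..}. {s. y < ennreal (s * t - \<Phi> t)})"
    unfolding complementary_def less_SUP_iff by auto
  also have "open \<dots>"
    by (intro open_UN ballI open_Collect_less continuous_intros continuous_on_ennreal)
  finally show "{x \<in> space borel. y < complementary \<Phi> x} \<in> sets borel" by simp
qed

text \<open>
  The linear lower bound on a Young function makes the Luxemburg norm dominate the mean. This is what
  keeps the Luxemburg norm of a positive function away from \<open>0\<close>.
\<close>

lemma average_le_luxemburg:
  assumes "young_function \<Phi>"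
    and [measurable]: "B \<in> sets lebesgue" "g \<in> borel_measurable lebesgue"
    and B: "0 < emeasure lebesgue B" "emeasure lebesgue B < \<infinity>"
  shows "average B g \<le> ennreal (1 + 1 / \<Phi> 1) * luxemburg (\<lambda>t. ennreal (\<Phi> t)) B g"
proof -
  note [measurable] = borel_measurable_young_function[OF assms(1)]
  have pos: "0 < \<Phi> 1" using assms(1) by (simp add: young_function_pos)
  have *: "average B g \<le> ennreal (1 + 1 / \<Phi> 1) * ennreal r"
    if r: "0 < r" and
      le: "average B (\<lambda>x. if g x = \<infinity> then \<infinity> else ennreal (\<Phi> (enn2real (g x) / r))) \<le> 1"
      for r
  proof -
    define h where "h x = (if g x = \<infinity> then \<infinity> else ennreal (\<Phi> (enn2real (g x) / r)))" for x
    have "h = (\<lambda>x. if g x = \<infinity> then \<infinity> else ennreal (\<Phi> (max 0 (enn2real (g x) / r))))"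
      using r by (auto simp: fun_eq_iff max_def h_def)
    then have [measurable]: "h \<in> borel_measurable lebesgue" by simp
    \<comment> \<open>the linear lower bound for \<open>\<Phi>\<close>, at the point \<open>g x / r\<close>\<close>
    have "average B g \<le> average B (\<lambda>x. ennreal r * (1 + ennreal (1 / \<Phi> 1) * h x))"
    proof (rule average_mono)
      fix x
      show "g x \<le> ennreal r * (1 + ennreal (1 / \<Phi> 1) * h x)"
      proof (cases "g x")
        case (real y)
        have "y \<le> r * (1 + \<Phi> (y / r) / \<Phi> 1)"
          using young_function_linear_bound[OF assms(1), of "y / r"] r real
          by (simp add: pos_divide_le_eq mult.commute)
        then have "ennreal y \<le> ennreal (r * (1 + 1 / \<Phi> 1 * \<Phi> (y / r)))"
          by (intro ennreal_leI) simp
        also have "\<dots> = ennreal r * (1 + ennreal (1 / \<Phi> 1) * h x)"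
          using real r pos young_function_nonneg[OF assms(1), of "y / r"]
          by (subst ennreal_mult, simp, simp, subst ennreal_plus, simp, simp, subst ennreal_mult)
            (auto simp: h_def)
        finally show ?thesis using real by simp
      next
        case top
        then show ?thesis using r pos by (simp add: h_def ennreal_mult_top)
      qed
    qed
    also have "\<dots> = ennreal r * (1 + ennreal (1 / \<Phi> 1) * average B h)"
    proof -
      have "average B (\<lambda>x. ennreal r * (1 + ennreal (1 / \<Phi> 1) * h x)) =
          ennreal r * average B (\<lambda>x. 1 + ennreal (1 / \<Phi> 1) * h x)"
        by (rule average_cmult) measurable
      also have "average B (\<lambda>x. 1 + ennreal (1 / \<Phi> 1) * h x) =
          average B (\<lambda>x. 1) + average B (\<lambda>x. ennreal (1 / \<Phi> 1) * h x)"
        by (rule average_add) measurable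
      also have "average B (\<lambda>x. ennreal (1 / \<Phi> 1) * h x) = ennreal (1 / \<Phi> 1) * average B h"
        by (rule average_cmult) measurable
      finally show ?thesis
        by (simp only: average_const[OF _ B] assms)
    qed
    also have "\<dots> \<le> ennreal r * (1 + ennreal (1 / \<Phi> 1) * 1)"
      using le unfolding h_def by (intro mult_left_mono add_left_mono) auto
    also have "\<dots> = ennreal (1 + 1 / \<Phi> 1) * ennreal r"
      using pos by (subst ennreal_plus) (auto simp: mult.commute)
    finally show ?thesis .
  qed
  define R where "R = {r. 0 < r \<and>
    average B (\<lambda>x. if g x = \<infinity> then \<infinity> else ennreal (\<Phi> (enn2real (g x) / r))) \<le> 1}"
  have "average B g \<le> ennreal (1 + 1 / \<Phi> 1) * (INF r\<in>R. ennreal r)"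
  proof (rule le_mult_INF_ennreal)
    show "0 < 1 + 1 / \<Phi> 1" using pos by (simp add: add_pos_pos)
    show "average B g \<le> ennreal (1 + 1 / \<Phi> 1) * ennreal r" if "r \<in> R" for r
      using that unfolding R_def by (intro *) blast+
  qed
  then show ?thesis
    by (simp only: luxemburg_def R_def)
qed

text \<open>
  Applied to \<open>g = 1 / w\<close>, this excludes the degenerate products \<open>0 * \<infinity>\<close> when the weight
  condition is split into its factors.
\<close>

lemma luxemburg_pos:
  assumes "young_function \<Phi>"
    and [measurable]: "B \<in> sets lebesgue" "g \<in> borel_measurable lebesgue"
    and B: "0 < emeasure lebesgue B" "emeasure lebesgue B < \<infinity>"
    and pos: "\<And>x. 0 < g x"
  shows "0 < luxemburg (\<lambda>t. ennreal (\<Phi> t)) B g"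
proof (rule ccontr)
  assume "\<not> ?thesis"
  then have "luxemburg (\<lambda>t. ennreal (\<Phi> t)) B g = 0"
    by (simp only: not_gr_zero)
  then have "average B g = 0"
    using average_le_luxemburg[OF assms(1-5)] by (simp only: mult_zero_right le_zero_eq)
  then have "(\<integral>\<^sup>+x\<in>B. g x \<partial>lebesgue) = 0"
    using B by (auto simp: average_def simp del: emeasure_completion)
  moreover have "(\<lambda>x. g x * indicator B x) \<in> borel_measurable lebesgue"
    by measurable
  ultimately have "AE x in lebesgue. g x * indicator B x = 0"
    by (simp only: nn_integral_0_iff_AE)
  then have AE: "AE x in lebesgue. x \<notin> B"
  proof eventually_elim
    case (elim x)
    then show ?case using pos[of x] by (auto simp: indicator_def)
  qed
  have "emeasure lebesgue B = 0"
    using AE_iff_measurable[THEN iffD1, OF _ _ AE, of B] by simp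
  then show False using B by simp
qed

text \<open>
  If \<open>r\<close> and \<open>s\<close> are admissible in the two Luxemburg norms, Young's inequality for
  \<open>\<bar>f\<bar> w / r\<close> and \<open>1 / (w s)\<close> bounds \<open>\<bar>f\<bar>\<close> by \<open>r s\<close> times the sum of the two
  integrands, each of which has mean at most \<open>1\<close>; then take infima. At the zeros of \<open>w\<close> the
  bound is trivial because the second integrand is infinite there. Positivity and
  finiteness of the norm of \<open>1 / w\<close> exclude the product \<open>0 * \<infinity> = 0\<close> on the right-hand side.
\<close>

lemma orlicz_hoelder:
  assumes young: "young_function \<Psi>"
    and [measurable]: "B \<in> sets lebesgue" "f \<in> borel_measurable lebesgue"
      "w \<in> borel_measurable lebesgue"
    and w: "\<And>x. 0 \<le> w x"
    and pos: "0 < luxemburg (\<lambda>t. ennreal (\<Psi> t)) B (\<lambda>x. inverse (ennreal (w x)))"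
    and fin: "luxemburg (\<lambda>t. ennreal (\<Psi> t)) B (\<lambda>x. inverse (ennreal (w x))) < \<infinity>" (is "?Y < _")
  shows "average B (\<lambda>x. ennreal \<bar>f x\<bar>) \<le>
    2 * luxemburg (complementary \<Psi>) B (\<lambda>x. ennreal \<bar>f x * w x\<bar>) * ?Y" (is "?A \<le> 2 * ?X * _")
proof -
  note [measurable] = borel_measurable_young_function[OF young]
  define G where "G r x = complementary \<Psi> (\<bar>f x * w x\<bar> / r)" for r x
  define H where "H s x = (if w x = 0 then \<infinity> else ennreal (\<Psi> (max 0 (1 / w x / s))))" for s x
  have [measurable]: "G r \<in> borel_measurable lebesgue" "H r \<in> borel_measurable lebesgue" for r
    unfolding G_def H_def by measurable
  define R where "R = {r::real. 0 < r \<and> average B (G r) \<le> 1}"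
  define S where "S = {s::real. 0 < s \<and> average B (H s) \<le> 1}"
  have X: "?X = (INF r\<in>R. ennreal r)"
    by (simp add: luxemburg_def R_def G_def [abs_def])
  have H: "(\<lambda>x. if inverse (ennreal (w x)) = \<infinity> then \<infinity>
      else ennreal (\<Psi> (enn2real (inverse (ennreal (w x))) / s))) = H s" if "0 < s" for s
  proof
    fix x
    show "(if inverse (ennreal (w x)) = \<infinity> then \<infinity>
      else ennreal (\<Psi> (enn2real (inverse (ennreal (w x))) / s))) = H s x"
      using w[of x] that
      by (cases "w x = 0") (simp_all add: H_def inverse_ennreal max_def inverse_eq_divide)
  qed
  have Y: "?Y = (INF s\<in>S. ennreal s)"
    unfolding luxemburg_def S_def by (intro INF_cong Collect_cong conj_cong refl) (simp only: H)
  have *: "?A \<le> ennreal (2 * r * s)" if "r \<in> R" "s \<in> S" for r s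
  proof -
    have r: "0 < r" "average B (G r) \<le> 1" and s: "0 < s" "average B (H s) \<le> 1"
      using that by (auto simp: R_def S_def)
    have "?A \<le> average B (\<lambda>x. ennreal (r * s) * (H s x + G r x))"
    proof (rule average_mono)
      fix x
      show "ennreal \<bar>f x\<bar> \<le> ennreal (r * s) * (H s x + G r x)"
      proof (cases "w x = 0")
        case True
        then show ?thesis using r s by (simp add: H_def ennreal_mult_top)
      next
        case False
        then have wx: "0 < w x" using w[of x] by simp
        have "ennreal \<bar>f x\<bar> = ennreal (r * s) * ennreal (\<bar>f x * w x\<bar> / r * (1 / w x / s))"
          using r s wx by (subst ennreal_mult[symmetric]) (auto simp: abs_mult)
        also have "\<dots> \<le> ennreal (r * s) * (H s x + G r x)"
          using young_inequality[OF young, of "1 / w x / s" "\<bar>f x * w x\<bar> / r"] wx s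
          by (intro mult_left_mono) (simp_all add: H_def G_def max_def)
        finally show ?thesis .
      qed
    qed
    also have "\<dots> = ennreal (r * s) * (average B (H s) + average B (G r))"
      by (simp add: average_cmult average_add)
    also have "\<dots> \<le> ennreal (r * s) * (1 + 1)"
      using r s by (intro mult_left_mono add_mono) auto
    also have "\<dots> = ennreal (2 * r * s)"
      using r s by (simp add: ennreal_mult' mult_ac)
    finally show ?thesis .
  qed
  have step: "?A \<le> ennreal (2 * s) * ?X" if "s \<in> S" for s
    unfolding X
  proof (rule le_mult_INF_ennreal)
    show s: "0 < 2 * s" using that by (simp add: S_def)
    fix r assume "r \<in> R"
    then show "?A \<le> ennreal (2 * s) * ennreal r"
      using *[OF _ that, of r] s by (simp add: ennreal_mult' mult_ac R_def)
  qed
  \<comment> \<open>If the norm of \<open>f w\<close> is \<open>0\<close>, a single admissible \<open>s0\<close> already gives mean \<open>0\<close>.\<close>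
  obtain s0 where s0: "s0 \<in> S"
    using fin unfolding Y by (auto simp: INF_less_iff)
  show ?thesis
  proof (cases ?X)
    case (real X)
    show ?thesis
    proof (cases "X = 0")
      case True
      then show ?thesis using step[OF s0] real by simp
    next
      case False
      have "?A \<le> ennreal (2 * X) * (INF s\<in>S. ennreal s)"
      proof (rule le_mult_INF_ennreal)
        fix s assume "s \<in> S"
        then show "?A \<le> ennreal (2 * X) * ennreal s"
          using step[of s] real by (simp add: S_def ennreal_mult' mult_ac)
      qed (use False real in simp)
      then show ?thesis using Y real by (simp add: ennreal_mult')
    qed
  next
    case top
    then show ?thesis using pos by (simp add: ennreal_top_mult)
  qed
qed

section \<open>Selecting a scattered subfamily\<close>

text \<open>
  Process the sets in decreasing order of \<open>a\<close> and keep a set exactly if the union of those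
  already kept covers at most the fraction \<open>l\<close> of it. The part of a kept set outside the earlier
  ones has a fixed proportion of its measure, and these parts are disjoint. A discarded set is, by
  construction, covered by more than the fraction \<open>l\<close> by kept sets with no smaller value of \<open>a\<close>. The induction removes a
  set with the smallest value, that is, the one processed last.
\<close>

lemma scattered_subfamily:
  fixes a :: "'a set \<Rightarrow> ennreal" and l :: real
  assumes "finite F" "\<And>B. B \<in> F \<Longrightarrow> B \<in> sets M \<and> emeasure M B < \<infinity>" "0 \<le> l" "l < 1"
  obtains S E where "S \<subseteq> F"
    "\<forall>B\<in>S. E B \<in> sets M \<and> E B \<subseteq> B \<and> ennreal (1 - l) * emeasure M B \<le> emeasure M (E B)"
    "disjoint_family_on E S"
    "\<forall>B\<in>F. B \<in> S \<or> ennreal l * emeasure M B < emeasure M (B \<inter> \<Union>{A\<in>S. a B \<le> a A})"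
proof -
  have "\<exists>S E. S \<subseteq> F \<and>
      (\<forall>B\<in>S. E B \<in> sets M \<and> E B \<subseteq> B \<and> ennreal (1 - l) * emeasure M B \<le> emeasure M (E B)) \<and>
      disjoint_family_on E S \<and>
      (\<forall>B\<in>F. B \<in> S \<or> ennreal l * emeasure M B < emeasure M (B \<inter> \<Union>{A\<in>S. a B \<le> a A}))"
    using assms(1,2)
  proof (induction "card F" arbitrary: F)
    case 0
    then show ?case by (auto simp: disjoint_family_on_def)
  next
    case (Suc n)
    then have "F \<noteq> {}" by auto
    with Suc.prems obtain B where B: "B \<in> F" "\<And>A. A \<in> F \<Longrightarrow> a B \<le> a A"
      by (metis arg_min_if_finite(1) arg_min_least)
    define F' where "F' = F - {B}"
    have F: "F = insert B F'" "B \<notin> F'" "finite F'" "n = card F'"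
      using B Suc unfolding F'_def by auto
    obtain S E where S: "S \<subseteq> F'"
      and E: "\<forall>B\<in>S. E B \<in> sets M \<and> E B \<subseteq> B \<and> ennreal (1 - l) * emeasure M B \<le> emeasure M (E B)"
      and disj: "disjoint_family_on E S"
      and cov: "\<forall>B\<in>F'. B \<in> S \<or> ennreal l * emeasure M B < emeasure M (B \<inter> \<Union>{A\<in>S. a B \<le> a A})"
      using Suc.hyps(1)[of F'] F Suc.prems by auto
    define U where "U = \<Union>S"
    have "finite S" using F S finite_subset by blast
    have sets: "A \<in> sets M" if "A \<in> insert B S" for A
      using that S F Suc.prems by auto
    then have U: "U \<in> sets M"
      unfolding U_def using \<open>finite S\<close> by (intro sets.finite_Union) auto
    show ?case
    proof (cases "ennreal l * emeasure M B < emeasure M (B \<inter> U)")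
      case True
      have "{A\<in>S. a B \<le> a A} = S" using S F B by auto
      with True S E disj cov show ?thesis
        unfolding F U_def by (intro exI[of _ S] exI[of _ E]) auto
    next
      case False
      define E' where "E' = E(B := B - U)"
      have "B \<notin> S" using S F by auto
      have "emeasure M B < \<infinity>" using Suc.prems F by auto
      then obtain b where b: "emeasure M B = ennreal b" "0 \<le> b"
        by (cases "emeasure M B") auto
      have "ennreal b = emeasure M (B \<inter> U) + emeasure M (B - U)"
        using U sets[of B] b plus_emeasure[of "B \<inter> U" M "B - U"]
        by (simp add: Int_Diff_Un Int_Diff_disjoint)
      also have "\<dots> \<le> ennreal (l * b) + emeasure M (B - U)"
        using False b assms(3) by (intro add_right_mono) (simp add: not_less ennreal_mult')
      finally have "ennreal ((1 - l) * b) \<le> emeasure M (B - U)"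
        using assms(3,4) b
        by (cases "emeasure M (B - U)") (auto simp: algebra_simps simp flip: ennreal_plus)
      then have "ennreal (1 - l) * emeasure M B \<le> emeasure M (E' B)"
        using b assms(4) by (simp add: E'_def ennreal_mult)
      then have E': "\<forall>A\<in>insert B S. E' A \<in> sets M \<and> E' A \<subseteq> A \<and>
          ennreal (1 - l) * emeasure M A \<le> emeasure M (E' A)"
        using E U sets[of B] \<open>B \<notin> S\<close> by (auto simp: E'_def)
      have "disjoint_family_on E' (insert B S)"
      proof -
        have "disjoint_family_on E' S"
          using disj \<open>B \<notin> S\<close> unfolding disjoint_family_on_def E'_def by auto
        moreover have "E' B \<inter> (\<Union>A\<in>S. E' A) = {}"
        proof -
          have "E' A \<subseteq> U" if "A \<in> S" for A
            using E that \<open>B \<notin> S\<close> unfolding E'_def U_def by auto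
          then have "(\<Union>A\<in>S. E' A) \<subseteq> U" by blast
          moreover have "E' B \<inter> U = {}" by (auto simp: E'_def)
          ultimately show ?thesis by blast
        qed
        ultimately show ?thesis
          using \<open>B \<notin> S\<close> by (simp add: disjoint_family_on_insert)
      qed
      moreover have "ennreal l * emeasure M A < emeasure M (A \<inter> \<Union>{A'\<in>insert B S. a A \<le> a A'})"
        if "A \<in> F" "A \<notin> insert B S" for A
      proof -
        have "ennreal l * emeasure M A < emeasure M (A \<inter> \<Union>{A'\<in>S. a A \<le> a A'})"
          using cov that F by auto
        also have "\<dots> \<le> emeasure M (A \<inter> \<Union>{A'\<in>insert B S. a A \<le> a A'})"
          using \<open>finite S\<close> sets that Suc.prems
          by (intro emeasure_mono sets.Int sets.finite_Union) auto
        finally show ?thesis .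
      qed
      ultimately show ?thesis
        using S E' F by (intro exI[of _ "insert B S"] exI[of _ E']) blast
    qed
  qed
  then show thesis using that by blast
qed

section \<open>The layer-cake formula and weighted measures\<close>

lemma ennreal_eq_nn_integral_below:
  "(\<integral>\<^sup>+s\<in>{0..}. indicator {t. t < a} (ennreal s) \<partial>lborel) = a"
proof -
  have "(\<integral>\<^sup>+s\<in>{0..}. indicator {t. t < a} (ennreal s) \<partial>lborel) =
      emeasure lborel {s. 0 \<le> s \<and> ennreal s < a}"
    by (subst nn_integral_indicator[symmetric])
      (auto intro!: nn_integral_cong simp: indicator_def simp del: nn_integral_indicator)
  also have "\<dots> = a"
  proof (cases a)
    case (real r)
    then have "{s. 0 \<le> s \<and> ennreal s < a} = {0..<r}"
      by (auto simp: ennreal_less_iff)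
    then show ?thesis using real by simp
  next
    case top
    then have "{s::real. 0 \<le> s \<and> ennreal s < a} = {0..}" by auto
    moreover have "ennreal r \<le> emeasure lborel {0::real..}" for r
      using emeasure_mono[of "{0..r}" "{0::real..}" lborel]
      by (cases "0 \<le> r") (auto simp: ennreal_neg)
    then have "emeasure lborel {0::real..} = top"
      by (metis ennreal_Ex_less_of_nat ennreal_of_nat_eq_real_of_nat less_top not_le)
    ultimately show ?thesis using top by simp
  qed
  finally show ?thesis .
qed

text \<open>
  Fubini's theorem for the region \<open>{(x, s). 0 \<le> s < h x}\<close>.
\<close>

lemma nn_integral_layer_cake:
  assumes "sigma_finite_measure M" and [measurable]: "h \<in> borel_measurable M"
  shows "(\<integral>\<^sup>+x. h x \<partial>M) = (\<integral>\<^sup>+s\<in>{0..}. emeasure M {x\<in>space M. ennreal s < h x} \<partial>lborel)"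
proof -
  interpret M: sigma_finite_measure M by fact
  interpret pair_sigma_finite M lborel ..
  have "(\<integral>\<^sup>+x. h x \<partial>M) =
      (\<integral>\<^sup>+x. \<integral>\<^sup>+s. indicator {0..} s * indicator {x\<in>space M. ennreal s < h x} x \<partial>lborel \<partial>M)"
  proof (rule nn_integral_cong)
    fix x assume x: "x \<in> space M"
    have "h x = (\<integral>\<^sup>+s\<in>{0..}. indicator {t. t < h x} (ennreal s) \<partial>lborel)"
      by (rule ennreal_eq_nn_integral_below[symmetric])
    also have "\<dots> = (\<integral>\<^sup>+s. indicator {0..} s * indicator {x\<in>space M. ennreal s < h x} x \<partial>lborel)"
      using x by (intro nn_integral_cong) (simp add: indicator_def)
    finally show "h x = \<dots>" .
  qed
  also have "\<dots> = (\<integral>\<^sup>+s. \<integral>\<^sup>+x. indicator {0..} s * indicator {x\<in>space M. ennreal s < h x} x \<partial>M \<partial>lborel)"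
    by (rule Fubini'[symmetric]) measurable
  also have "\<dots> = (\<integral>\<^sup>+s\<in>{0..}. emeasure M {x\<in>space M. ennreal s < h x} \<partial>lborel)"
    by (intro nn_integral_cong) (simp add: nn_integral_cmult mult.commute)
  finally show ?thesis .
qed

lemma sigma_finite_lebesgue: "sigma_finite_measure (lebesgue :: ('a::euclidean_space) measure)"
proof -
  obtain A :: "'a set set" where "countable A" "A \<subseteq> sets lborel" "\<Union>A = space lborel"
      "\<forall>a\<in>A. emeasure lborel a \<noteq> \<infinity>"
    using lborel.sigma_finite_countable by blast
  then show ?thesis
    by (intro sigma_finite_measure.intro exI[of _ A]) auto
qed

lemma sigma_finite_weighted:
  "w \<in> borel_measurable lebesgue \<Longrightarrow> sigma_finite_measure (weighted w)"
  unfolding weighted_def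
  by (subst sigma_finite_measure.sigma_finite_iff_density_finite[OF sigma_finite_lebesgue]) auto

lemma space_weighted [simp]: "space (weighted w) = UNIV"
  by (simp add: weighted_def)

lemma sets_weighted [simp, measurable_cong]: "sets (weighted w) = sets lebesgue"
  by (simp add: weighted_def)

section \<open>Suprema over the members of a basis containing a point\<close>

lemma is_basisD:
  assumes "is_basis \<B>" "B \<in> \<B>"
  shows "open B" "B \<in> sets lebesgue" "emeasure lebesgue B < \<infinity>" "0 < emeasure lebesgue B"
proof -
  show B: "open B" "B \<in> sets lebesgue" "emeasure lebesgue B < \<infinity>"
    using assms by (auto simp: is_basis_def)
  have "\<not> negligible B"
    using assms by (intro open_not_negligible) (auto simp: is_basis_def)
  then show "0 < emeasure lebesgue B"
    using B by (simp add: negligible_iff_emeasure0 zero_less_iff_neq_zero del: emeasure_completion)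
qed

text \<open>
  This is why maximal functions over open sets are measurable: the superlevel set at \<open>t\<close> is the
  union of the sets whose value exceeds \<open>t\<close>.
\<close>

lemma open_superlevel_SUP_containing:
  assumes "\<And>B. B \<in> \<B> \<Longrightarrow> open B"
  shows "open {x. t < (SUP B\<in>{B\<in>\<B>. x \<in> B}. a B :: ennreal)}"
proof -
  have "{x. t < (SUP B\<in>{B\<in>\<B>. x \<in> B}. a B)} = \<Union>{B\<in>\<B>. t < a B}"
    by (auto simp: less_SUP_iff)
  then show ?thesis using assms by auto
qed

text \<open>
  For each rational \<open>r\<close>, Lindelof's theorem replaces the sets with \<open>a B > r\<close> by countably many
  that cover the same points; density of the rationals shows that all of these together
  give the same supremum.
\<close>

lemma countable_subfamily_SUP_containing:
  fixes \<B> :: "'a::second_countable_topology set set" and a :: "'a set \<Rightarrow> ennreal"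
  assumes "\<And>B. B \<in> \<B> \<Longrightarrow> open B"
  obtains \<C> where "countable \<C>" "\<C> \<subseteq> \<B>"
    "\<And>x. (SUP B\<in>{B\<in>\<C>. x \<in> B}. a B) = (SUP B\<in>{B\<in>\<B>. x \<in> B}. a B)"
proof -
  define L where "L r = {B\<in>\<B>. ennreal (real_of_rat r) < a B}" for r
  define \<C> where "\<C> r = (SOME \<C>. \<C> \<subseteq> L r \<and> countable \<C> \<and> \<Union>\<C> = \<Union>(L r))" for r
  have \<C>: "\<C> r \<subseteq> L r \<and> countable (\<C> r) \<and> \<Union>(\<C> r) = \<Union>(L r)" for r
    unfolding \<C>_def
  proof (rule someI_ex)
    obtain \<D> where "\<D> \<subseteq> L r" "countable \<D>" "\<Union>\<D> = \<Union>(L r)"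
      using Lindelof[of "L r"] assms unfolding L_def by blast
    then show "\<exists>\<D>. \<D> \<subseteq> L r \<and> countable \<D> \<and> \<Union>\<D> = \<Union>(L r)" by blast
  qed
  have "(SUP B\<in>{B\<in>\<B>. x \<in> B}. a B) \<le> (SUP B\<in>{B\<in>(\<Union>r. \<C> r). x \<in> B}. a B)" for x
  proof (rule SUP_least, rule ccontr)
    fix B assume B: "B \<in> {B\<in>\<B>. x \<in> B}"
      and "\<not> a B \<le> (SUP B\<in>{B\<in>(\<Union>r. \<C> r). x \<in> B}. a B)"
    from ennreal_rat_dense[OF this(2)[unfolded not_le]]
    obtain r where r: "(SUP B\<in>{B\<in>(\<Union>r. \<C> r). x \<in> B}. a B) < real_of_rat r" "real_of_rat r < a B"
      by (elim exE conjE)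
    with B have "x \<in> \<Union>(L r)" by (auto simp: L_def)
    with \<C>[of r] have "x \<in> \<Union>(\<C> r)" by simp
    then obtain A where "A \<in> \<C> r" "x \<in> A" by auto
    then have "ennreal (real_of_rat r) < a A" "a A \<le> (SUP B\<in>{B\<in>(\<Union>r. \<C> r). x \<in> B}. a B)"
      using \<C>[of r] unfolding L_def by (auto intro!: SUP_upper)
    with r show False by simp
  qed
  moreover have sub: "(\<Union>r. \<C> r) \<subseteq> \<B>" using \<C> unfolding L_def by blast
  then have "(SUP B\<in>{B\<in>(\<Union>r. \<C> r). x \<in> B}. a B) \<le> (SUP B\<in>{B\<in>\<B>. x \<in> B}. a B)" for x
    by (intro SUP_subset_mono) auto
  moreover have "countable (\<Union>r. \<C> r)" using \<C> by auto
  ultimately show thesis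
    using sub by (intro that[of "\<Union>r. \<C> r"] antisym)
qed

section \<open>Passing from condition (A) to Lebesgue measure\<close>

text \<open>
  Let \<open>S\<close> be the scattered subfamily of \<open>F\<close> for the values \<open>a\<close> and the threshold \<open>l\<close>, and
  let \<open>V t\<close> be the union of its members with value above \<open>t\<close>. Every \<open>B\<close> in \<open>F\<close> with
  \<open>a B > t\<close> is either in \<open>S\<close> or filled by \<open>V t\<close> to a fraction above \<open>l\<close>, so the superlevel set
  of the maximal function of \<open>a\<close> lies where the maximal function of the indicator of \<open>V t\<close>
  exceeds \<open>l\<close>. Condition (A) bounds its weighted measure by that of \<open>V t\<close>, and integrating in
  \<open>t\<close> leaves the sum of \<open>a A\<close> times the weighted measure of \<open>A\<close> over \<open>A\<close> in \<open>S\<close>.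
  By hypothesis each term is controlled by \<open>b A\<close> times the Lebesgue measure of \<open>A\<close>, hence of
  \<open>E A\<close>; since the sets \<open>E A\<close> are disjoint and contained in \<open>A\<close>, the sum is at most the
  integral of the maximal function of \<open>b\<close>.
\<close>

lemma maximal_transference_finite:
  fixes a b :: "(real ^ 'n) set \<Rightarrow> ennreal" and c l :: real
  assumes basis: "is_basis \<B>"
    and [measurable]: "u \<in> borel_measurable lebesgue"
    and l: "0 < l" "l < 1"
    and A: "\<And>E. E \<in> sets lebesgue \<Longrightarrow>
      emeasure (weighted u) {x. maximal \<B> (indicator E) x > ennreal l} \<le> ennreal c * emeasure (weighted u) E"
    and ab: "\<And>B. B \<in> \<B> \<Longrightarrow> emeasure (weighted u) B * a B \<le> K * (emeasure lebesgue B * b B)"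
    and F: "finite F" "F \<subseteq> \<B>"
  shows "(\<integral>\<^sup>+x. (SUP B\<in>{B\<in>F. x \<in> B}. a B) \<partial>weighted u) \<le>
    ennreal (c / (1 - l)) * K * (\<integral>\<^sup>+x. (SUP B\<in>{B\<in>\<B>. x \<in> B}. b B) \<partial>lebesgue)"
proof -
  let ?\<mu> = "weighted u"
  note basisD = is_basisD[OF basis]
  obtain S E where S: "S \<subseteq> F"
    and E: "\<forall>B\<in>S. E B \<in> sets lebesgue \<and> E B \<subseteq> B \<and>
      ennreal (1 - l) * emeasure lebesgue B \<le> emeasure lebesgue (E B)"
    and disj: "disjoint_family_on E S"
    and cov: "\<forall>B\<in>F. B \<in> S \<or>
       ennreal l * emeasure lebesgue B < emeasure lebesgue (B \<inter> \<Union>{A\<in>S. a B \<le> a A})"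
    using scattered_subfamily[of F lebesgue l a thesis] F basisD l by force
  have "finite S" and SB: "S \<subseteq> \<B>" using S F finite_subset by auto
  define V where "V t = \<Union>{A\<in>S. t < a A}" for t
  have V: "V t \<in> sets lebesgue" for t
    unfolding V_def using SB basisD(2) \<open>finite S\<close> by (intro sets.finite_Union) auto
  have sets [measurable]: "A \<in> sets lebesgue" if "A \<in> S" for A using that SB basisD by auto
  have level: "emeasure ?\<mu> {x. t < (SUP B\<in>{B\<in>F. x \<in> B}. a B)} \<le>
      ennreal c * (\<Sum>A\<in>S. emeasure ?\<mu> A * indicator {s. s < a A} t)" for t
  proof -
    have "B \<subseteq> {x. maximal \<B> (indicator (V t)) x > ennreal l}" if "B \<in> F" "t < a B" for B
    proof
      fix x assume "x \<in> B"
      have B: "B \<in> \<B>" using that F by auto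
      have "ennreal l * emeasure lebesgue B < emeasure lebesgue (B \<inter> V t)"
      proof (cases "B \<in> S")
        case True
        then have "B \<inter> V t = B" using that by (auto simp: V_def)
        then show ?thesis
          using ennreal_mult_strict_right_mono[of "ennreal l" 1 "emeasure lebesgue B"] basisD[OF B] l
          by (simp add: less_top)
      next
        case False
        then have "ennreal l * emeasure lebesgue B < emeasure lebesgue (B \<inter> \<Union>{A\<in>S. a B \<le> a A})"
          using cov that by auto
        also have "\<dots> \<le> emeasure lebesgue (B \<inter> V t)"
          using that V basisD[OF B] by (intro emeasure_mono) (auto simp: V_def)
        finally show ?thesis .
      qed
      then have "ennreal l < emeasure lebesgue (B \<inter> V t) / emeasure lebesgue B"
        using basisD(3,4)[OF B] by (intro less_divide_ennrealI)
      also have "\<dots> = average B (\<lambda>y. ennreal \<bar>indicator (V t) y\<bar>)"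
        using V basisD[OF B] unfolding average_def
        by (subst nn_integral_indicator[symmetric])
          (auto intro!: arg_cong2[where f="(/)"] nn_integral_cong simp: indicator_def)
      also have "\<dots> \<le> maximal \<B> (indicator (V t)) x"
        unfolding maximal_def using B \<open>x \<in> B\<close> by (intro SUP_upper) auto
      finally show "x \<in> {x. maximal \<B> (indicator (V t)) x > ennreal l}" by simp
    qed
    then have "emeasure ?\<mu> {x. t < (SUP B\<in>{B\<in>F. x \<in> B}. a B)} \<le>
        emeasure ?\<mu> {x. maximal \<B> (indicator (V t)) x > ennreal l}"
      using open_superlevel_SUP_containing[of \<B>] basisD unfolding maximal_def
      by (intro emeasure_mono) (auto simp: less_SUP_iff subset_eq)
    also have "\<dots> \<le> ennreal c * emeasure ?\<mu> (V t)" by (rule A[OF V])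
    also have "emeasure ?\<mu> (V t) \<le> (\<Sum>A\<in>{A\<in>S. t < a A}. emeasure ?\<mu> A)"
    proof -
      have "{A\<in>S. t < a A} \<subseteq> sets lebesgue" using sets by auto
      then show ?thesis
        unfolding V_def using \<open>finite S\<close>
          emeasure_subadditive_finite[of "{A\<in>S. t < a A}" "\<lambda>A. A" ?\<mu>] by simp
    qed
    also have "\<dots> = (\<Sum>A\<in>S. emeasure ?\<mu> A * indicator {s. s < a A} t)"
      unfolding sum.inter_filter[OF \<open>finite S\<close>] by (rule sum.cong) (simp_all add: indicator_def)
    finally show ?thesis by (simp add: mult_left_mono)
  qed
  have open_F: "open {x. t < (SUP B\<in>{B\<in>F. x \<in> B}. a B)}" for t
    using F basisD by (intro open_superlevel_SUP_containing) auto
  have [measurable]: "(\<lambda>x. SUP B\<in>{B\<in>F. x \<in> B}. a B) \<in> borel_measurable ?\<mu>"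
    by (rule borel_measurableI_greater) (use open_F in auto)
  have "(\<integral>\<^sup>+x. (SUP B\<in>{B\<in>F. x \<in> B}. a B) \<partial>?\<mu>) =
      (\<integral>\<^sup>+s\<in>{0..}. emeasure ?\<mu> {x. ennreal s < (SUP B\<in>{B\<in>F. x \<in> B}. a B)} \<partial>lborel)"
    by (subst nn_integral_layer_cake[OF sigma_finite_weighted]) auto
  also have "\<dots> \<le> (\<integral>\<^sup>+s. ennreal c * (\<Sum>A\<in>S. emeasure ?\<mu> A * (indicator {s. s < a A} (ennreal s) * indicator {0..} s)) \<partial>lborel)"
    using level
    by (intro nn_integral_mono) (auto simp: indicator_def sum_distrib_right)
  also have "\<dots> = ennreal c * (\<Sum>A\<in>S. emeasure ?\<mu> A * (\<integral>\<^sup>+s. indicator {s. s < a A} (ennreal s) * indicator {0..} s \<partial>lborel))"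
    by (simp add: nn_integral_cmult nn_integral_sum)
  also have "\<dots> = ennreal c * (\<Sum>A\<in>S. emeasure ?\<mu> A * a A)"
    by (simp add: ennreal_eq_nn_integral_below)
  also have "\<dots> \<le> ennreal c * (\<Sum>A\<in>S. K * (ennreal (1 / (1 - l)) * (emeasure lebesgue (E A) * b A)))"
  proof (intro mult_left_mono sum_mono)
    fix B assume B: "B \<in> S"
    have "emeasure lebesgue B = ennreal (1 / (1 - l)) * (ennreal (1 - l) * emeasure lebesgue B)"
      using l by (simp add: mult.assoc[symmetric] ennreal_mult'[symmetric])
    also have "\<dots> \<le> ennreal (1 / (1 - l)) * emeasure lebesgue (E B)"
      using bspec[OF E B] by (intro mult_left_mono) auto
    finally have "emeasure lebesgue B \<le> ennreal (1 / (1 - l)) * emeasure lebesgue (E B)" .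
    then have "K * (emeasure lebesgue B * b B) \<le>
        K * (ennreal (1 / (1 - l)) * emeasure lebesgue (E B) * b B)"
      by (intro mult_left_mono mult_right_mono) simp_all
    moreover have "emeasure ?\<mu> B * a B \<le> K * (emeasure lebesgue B * b B)"
      using ab B SB by blast
    ultimately show "emeasure ?\<mu> B * a B \<le>
        K * (ennreal (1 / (1 - l)) * (emeasure lebesgue (E B) * b B))"
      by (simp only: mult.assoc)
  qed simp
  also have "\<dots> = ennreal (c / (1 - l)) * K * (\<Sum>A\<in>S. b A * emeasure lebesgue (E A))"
  proof -
    have "ennreal (c / (1 - l)) = ennreal c * ennreal (1 / (1 - l))"
      using l by (simp flip: ennreal_mult'')
    then show ?thesis by (simp only: sum_distrib_left mult_ac)
  qed
  also have "(\<Sum>A\<in>S. b A * emeasure lebesgue (E A)) = (\<integral>\<^sup>+x. (\<Sum>A\<in>S. b A * indicator (E A) x) \<partial>lebesgue)"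
    using E by (subst nn_integral_sum) (auto simp: nn_integral_cmult_indicator)
  also have "\<dots> \<le> (\<integral>\<^sup>+x. (SUP B\<in>{B\<in>\<B>. x \<in> B}. b B) \<partial>lebesgue)"
  proof (rule nn_integral_mono)
    fix x
    show "(\<Sum>A\<in>S. b A * indicator (E A) x) \<le> (SUP B\<in>{B\<in>\<B>. x \<in> B}. b B)"
    proof (cases "\<exists>A\<in>S. x \<in> E A")
      case True
      then obtain A where A: "A \<in> S" "x \<in> E A" by auto
      have "x \<notin> E A'" if "A' \<in> S - {A}" for A'
        using disj A that unfolding disjoint_family_on_def by blast
      then have "(\<Sum>A\<in>S. b A * indicator (E A) x) = b A"
        using A \<open>finite S\<close> by (subst sum.remove[of _ A]) auto
      also have "\<dots> \<le> (SUP B\<in>{B\<in>\<B>. x \<in> B}. b B)"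
        using A E SB by (intro SUP_upper) auto
      finally show ?thesis .
    qed (auto simp: indicator_def sum.neutral)
  qed
  finally show ?thesis by (simp add: mult_left_mono)
qed

text \<open>
  The general principle behind the theorem: under condition (A), a comparison of set functions on
  individual members of the basis implies the comparison of the integrals of their maximal functions.
  The constant depends only on the basis and the weight; \<open>K\<close> is the constant of the comparison. The
  finite case extends by a countable subfamily and monotone convergence.
\<close>

lemma maximal_transference:
  fixes \<B> :: "(real ^ 'n) set set"
  assumes basis: "is_basis \<B>" and A: "condition_A \<B> u"
  obtains C :: real where "0 \<le> C"
    "\<And>a b K. (\<And>B. B \<in> \<B> \<Longrightarrow> emeasure (weighted u) B * a B \<le> K * (emeasure lebesgue B * b B)) \<Longrightarrow>
      (\<integral>\<^sup>+x. (SUP B\<in>{B\<in>\<B>. x \<in> B}. a B) \<partial>weighted u) \<le>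
        ennreal C * K * (\<integral>\<^sup>+x. (SUP B\<in>{B\<in>\<B>. x \<in> B}. b B) \<partial>lebesgue)"
proof -
  obtain l c :: real where l: "0 < l" "l < 1" "0 < c"
    and lc: "\<forall>E\<in>sets lebesgue. emeasure (weighted u) {x. maximal \<B> (indicator E) x > ennreal l}
        \<le> ennreal c * emeasure (weighted u) E"
    using A unfolding condition_A_def by blast
  have u: "u \<in> borel_measurable lebesgue"
    using A by (simp add: condition_A_def weight_def)
  have op: "open B" if "B \<in> \<B>" for B
    using basis that by (simp add: is_basis_def)
  show thesis
  proof (rule that[of "c / (1 - l)"])
    show "0 \<le> c / (1 - l)" using l by simp
    fix a b :: "(real ^ 'n) set \<Rightarrow> ennreal" and K
    assume ab: "\<And>B. B \<in> \<B> \<Longrightarrow> emeasure (weighted u) B * a B \<le> K * (emeasure lebesgue B * b B)"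
    obtain \<C> where \<C>: "countable \<C>" "\<C> \<subseteq> \<B>"
      "\<And>x. (SUP B\<in>{B\<in>\<C>. x \<in> B}. a B) = (SUP B\<in>{B\<in>\<B>. x \<in> B}. a B)"
      using countable_subfamily_SUP_containing[of \<B> a] op by blast
    define F where "F n = {B\<in>\<C>. to_nat_on \<C> B \<le> n}" for n
    have fin: "finite (F n)" for n
    proof (rule inj_on_finite)
      show "inj_on (to_nat_on \<C>) (F n)"
        using \<C>(1) by (auto simp: F_def intro: inj_on_subset[OF inj_on_to_nat_on])
      show "to_nat_on \<C> ` F n \<subseteq> {..n}" by (auto simp: F_def)
    qed simp
    have F: "F n \<subseteq> \<B>" for n using \<C>(2) by (auto simp: F_def)
    have "(SUP B\<in>{B\<in>\<B>. x \<in> B}. a B) = (SUP n. SUP B\<in>{B\<in>F n. x \<in> B}. a B)" for x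
    proof -
      have "{B\<in>\<C>. x \<in> B} = (\<Union>n. {B\<in>F n. x \<in> B})"
        by (auto simp: F_def)
      then show ?thesis
        unfolding \<C>(3)[symmetric] by (simp only: SUP_UNION)
    qed
    then have "(\<integral>\<^sup>+x. (SUP B\<in>{B\<in>\<B>. x \<in> B}. a B) \<partial>weighted u) =
        (\<integral>\<^sup>+x. (SUP n. SUP B\<in>{B\<in>F n. x \<in> B}. a B) \<partial>weighted u)"
      by simp
    also have "\<dots> = (SUP n. \<integral>\<^sup>+x. (SUP B\<in>{B\<in>F n. x \<in> B}. a B) \<partial>weighted u)"
    proof (rule nn_integral_monotone_convergence_SUP)
      show "incseq (\<lambda>n x. SUP B\<in>{B\<in>F n. x \<in> B}. a B)"
        by (intro monoI le_funI SUP_subset_mono) (auto simp: F_def)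
      show "(\<lambda>x. SUP B\<in>{B\<in>F n. x \<in> B}. a B) \<in> borel_measurable (weighted u)" for n
      proof (rule borel_measurableI_greater)
        fix t
        have "open {x. t < (SUP B\<in>{B\<in>F n. x \<in> B}. a B)}"
          using F op by (intro open_superlevel_SUP_containing) auto
        then show "{x \<in> space (weighted u). t < (SUP B\<in>{B\<in>F n. x \<in> B}. a B)} \<in> sets (weighted u)"
          by simp
      qed
    qed
    also have "\<dots> \<le> ennreal (c / (1 - l)) * K * (\<integral>\<^sup>+x. (SUP B\<in>{B\<in>\<B>. x \<in> B}. b B) \<partial>lebesgue)"
      using lc by (intro SUP_least maximal_transference_finite basis u l ab fin F) auto
    finally show "(\<integral>\<^sup>+x. (SUP B\<in>{B\<in>\<B>. x \<in> B}. a B) \<partial>weighted u) \<le>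
        ennreal (c / (1 - l)) * K * (\<integral>\<^sup>+x. (SUP B\<in>{B\<in>\<B>. x \<in> B}. b B) \<partial>lebesgue)" .
  qed
qed

section \<open>The two-weight inequality\<close>

lemma Lp_norm_weighted:
  assumes "0 < q" and [measurable]: "f \<in> borel_measurable lebesgue" "w \<in> borel_measurable lebesgue"
    and w: "\<And>x. 0 \<le> w x"
  shows "Lp_norm q (weighted (\<lambda>x. w x powr q)) (\<lambda>x. ennreal \<bar>f x\<bar>) =
    Lp_norm q lebesgue (\<lambda>x. ennreal \<bar>f x * w x\<bar>)"
proof -
  have "(\<integral>\<^sup>+x. epowr (ennreal \<bar>f x\<bar>) q \<partial>weighted (\<lambda>x. w x powr q)) =
      (\<integral>\<^sup>+x. ennreal (w x powr q) * epowr (ennreal \<bar>f x\<bar>) q \<partial>lebesgue)"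
    unfolding weighted_def by (rule nn_integral_density) measurable
  also have "\<dots> = (\<integral>\<^sup>+x. epowr (ennreal \<bar>f x * w x\<bar>) q \<partial>lebesgue)"
    using w by (intro nn_integral_cong)
      (simp add: epowr_ennreal abs_mult powr_mult mult.commute flip: ennreal_mult)
  finally show ?thesis by (simp add: Lp_norm_def)
qed

text \<open>
  This is the comparison on a single set that the weight condition provides. If the weight \<open>u\<close>
  has mean zero on \<open>B\<close>, the left-hand side vanishes. Otherwise the product of the norms of
  \<open>1 / w j\<close> is finite and its factors are positive, so every factor is finite and Hoelder's inequality
  applies to each index.
\<close>

lemma prod_average_le_orlicz:
  assumes p: "0 < p"
    and B: "B \<in> sets lebesgue" "emeasure lebesgue B < \<infinity>" "0 < emeasure lebesgue B"
    and young: "\<And>j. j \<in> {1..m} \<Longrightarrow> young_function (\<Psi> j)"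
    and f: "\<And>j. j \<in> {1..m} \<Longrightarrow> f j \<in> borel_measurable lebesgue"
    and w: "\<And>j. j \<in> {1..m} \<Longrightarrow> w j \<in> borel_measurable lebesgue"
    and w0: "\<And>j x. j \<in> {1..m} \<Longrightarrow> 0 \<le> w j x"
    and u: "u \<in> borel_measurable lebesgue"
    and K: "epowr (average B (\<lambda>x. ennreal (u x))) (1 / p) *
      (\<Prod>j=1..m. luxemburg (\<lambda>t. ennreal (\<Psi> j t)) B (\<lambda>x. inverse (ennreal (w j x)))) \<le> K"
    and fin: "K < \<infinity>"
  shows "emeasure (weighted u) B * epowr (\<Prod>j=1..m. average B (\<lambda>x. ennreal \<bar>f j x\<bar>)) p \<le>
    epowr (2 ^ m * K) p * (emeasure lebesgue B *
      epowr (\<Prod>j=1..m. luxemburg (complementary (\<Psi> j)) B (\<lambda>x. ennreal \<bar>f j x * w j x\<bar>)) p)"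
proof -
  define X where "X j = luxemburg (complementary (\<Psi> j)) B (\<lambda>x. ennreal \<bar>f j x * w j x\<bar>)" for j
  define Y where "Y j = luxemburg (\<lambda>t. ennreal (\<Psi> j t)) B (\<lambda>x. inverse (ennreal (w j x)))" for j
  define v where "v = average B (\<lambda>x. ennreal (u x))"
  let ?c = "\<Prod>j=1..m. average B (\<lambda>x. ennreal \<bar>f j x\<bar>)"
  have meas: "emeasure (weighted u) B = emeasure lebesgue B * v"
  proof -
    have "emeasure (weighted u) B = (\<integral>\<^sup>+x\<in>B. ennreal (u x) \<partial>lebesgue)"
      unfolding weighted_def using u B(1) by (intro emeasure_density) auto
    then show ?thesis
      using B unfolding v_def average_def
      by (simp add: ennreal_times_divide mult.commute[of "emeasure lebesgue B"] mult_divide_eq_ennreal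
          del: emeasure_completion)
  qed
  have "v * epowr ?c p \<le> epowr (2 ^ m * K) p * epowr (\<Prod>j=1..m. X j) p"
  proof (cases "v = 0")
    case False
    have pos: "0 < Y j" if "j \<in> {1..m}" for j
      unfolding Y_def
    proof (rule luxemburg_pos[OF young[OF that] B(1) _ B(3,2)])
      note [measurable] = w[OF that]
      show "(\<lambda>x. inverse (ennreal (w j x))) \<in> borel_measurable lebesgue" by measurable
    qed (simp add: ennreal_inverse_positive)
    have "epowr v (1 / p) \<noteq> 0"
      using False epowr_inverse_exponent'[OF p, of v] by (auto simp: epowr_def)
    then have "(\<Prod>j=1..m. Y j) \<noteq> top"
    proof (rule contrapos_nn)
      assume "(\<Prod>j=1..m. Y j) = top"
      then have "K = top"
        using K \<open>epowr v (1 / p) \<noteq> 0\<close> by (simp add: v_def Y_def top_unique)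
      then show "epowr v (1 / p) = 0" using fin by simp
    qed
    then have "Y j < \<infinity>" if "j \<in> {1..m}" for j
      using pos that by (auto simp: ennreal_prod_eq_top less_top zero_less_iff_neq_zero)
    then have "average B (\<lambda>x. ennreal \<bar>f j x\<bar>) \<le> 2 * X j * Y j" if "j \<in> {1..m}" for j
      using orlicz_hoelder[OF young B(1) f w w0] pos that unfolding X_def Y_def by blast
    then have "?c \<le> (\<Prod>j=1..m. 2 * X j * Y j)"
      by (intro prod_mono_ennreal) auto
    also have "\<dots> = 2 ^ m * (\<Prod>j=1..m. X j) * (\<Prod>j=1..m. Y j)"
      by (simp add: prod.distrib)
    finally have "epowr v (1 / p) * ?c \<le> epowr v (1 / p) * (2 ^ m * (\<Prod>j=1..m. X j) * (\<Prod>j=1..m. Y j))"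
      by (rule mult_left_mono) simp
    also have "\<dots> = 2 ^ m * (epowr v (1 / p) * (\<Prod>j=1..m. Y j)) * (\<Prod>j=1..m. X j)"
      by (simp only: mult_ac)
    also have "\<dots> \<le> 2 ^ m * K * (\<Prod>j=1..m. X j)"
      using K by (intro mult_right_mono mult_left_mono) (auto simp: v_def Y_def)
    finally have "epowr (epowr v (1 / p) * ?c) p \<le> epowr (2 ^ m * K * (\<Prod>j=1..m. X j)) p"
      using p by (intro epowr_mono) auto
    then show ?thesis
      using p by (simp only: epowr_mult epowr_inverse_exponent')
  qed simp
  then have "emeasure lebesgue B * (v * epowr ?c p) \<le>
      emeasure lebesgue B * (epowr (2 ^ m * K) p * epowr (\<Prod>j=1..m. X j) p)"
    by (rule mult_left_mono) simp
  then show ?thesis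
    by (simp only: meas X_def mult_ac)
qed

theorem theorem3p1:
  fixes m :: nat and p :: real and q :: "nat \<Rightarrow> real"
    and \<B> :: "(real ^ 'n) set set"
    and \<Psi> :: "nat \<Rightarrow> real \<Rightarrow> real"
    and \<nu> :: "real ^ 'n \<Rightarrow> real" and w :: "nat \<Rightarrow> real ^ 'n \<Rightarrow> real"
  assumes "1 \<le> m"
    and "\<And>j. j \<in> {1..m} \<Longrightarrow> 1 < q j"
    and "0 < p"
    and "1 / p = (\<Sum>j=1..m. 1 / q j)"
    and "is_basis \<B>"
    and "\<And>j. j \<in> {1..m} \<Longrightarrow> young_function (\<Psi> j)"
    and "multi_bounded m q (\<lambda>j. lebesgue) p lebesgue
           (multi_orlicz_maximal m \<B> (\<lambda>j. complementary (\<Psi> j)))"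
    and "weight \<B> \<nu>"
    and "\<And>j. j \<in> {1..m} \<Longrightarrow> weight \<B> (w j)"
    and "condition_A \<B> (\<lambda>x. \<nu> x powr p)"
    and "(SUP B\<in>\<B>. epowr (average B (\<lambda>x. ennreal (\<nu> x powr p))) (1 / p) *
            (\<Prod>j=1..m. luxemburg (\<lambda>t. ennreal (\<Psi> j t)) B (\<lambda>x. inverse (ennreal (w j x))))) < \<infinity>"
  shows "multi_bounded m q (\<lambda>j. weighted (\<lambda>x. w j x powr q j)) p (weighted (\<lambda>x. \<nu> x powr p))
           (multi_maximal m \<B>)"
proof -
  note p = \<open>0 < p\<close>
  have w: "w j \<in> borel_measurable lebesgue" "\<And>x. 0 \<le> w j x" if "j \<in> {1..m}" for j
    using assms(9)[OF that] by (simp_all add: weight_def)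
  have u: "(\<lambda>x. \<nu> x powr p) \<in> borel_measurable lebesgue"
    using assms(10) by (simp add: condition_A_def weight_def)
  define K where "K = (SUP B\<in>\<B>. epowr (average B (\<lambda>x. ennreal (\<nu> x powr p))) (1 / p) *
      (\<Prod>j=1..m. luxemburg (\<lambda>t. ennreal (\<Psi> j t)) B (\<lambda>x. inverse (ennreal (w j x)))))"
  have K: "K < \<infinity>" using assms(11) by (simp add: K_def)
  obtain C0 :: real where C0: "0 \<le> C0"
    and orlicz: "\<And>f. (\<And>j. j \<in> {1..m} \<Longrightarrow> in_Lp (q j) lebesgue (f j)) \<Longrightarrow>
       Lp_norm p lebesgue (multi_orlicz_maximal m \<B> (\<lambda>j. complementary (\<Psi> j)) f) \<le>
       ennreal C0 * (\<Prod>j=1..m. Lp_norm (q j) lebesgue (\<lambda>x. ennreal \<bar>f j x\<bar>))"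
    using assms(7) unfolding multi_bounded_def by auto
  obtain C1 :: real where C1: "0 \<le> C1" and transfer: "\<And>a b K.
      (\<And>B. B \<in> \<B> \<Longrightarrow> emeasure (weighted (\<lambda>x. \<nu> x powr p)) B * a B \<le> K * (emeasure lebesgue B * b B)) \<Longrightarrow>
      (\<integral>\<^sup>+x. (SUP B\<in>{B\<in>\<B>. x \<in> B}. a B) \<partial>weighted (\<lambda>x. \<nu> x powr p)) \<le>
        ennreal C1 * K * (\<integral>\<^sup>+x. (SUP B\<in>{B\<in>\<B>. x \<in> B}. b B) \<partial>lebesgue)"
    using maximal_transference[OF assms(5,10)] by blast
  \<comment> \<open>\<open>2 ^ m\<close> collects the factor \<open>2\<close> of each of the \<open>m\<close> Hoelder inequalities.\<close>
  define D where "D = epowr (ennreal C1 * epowr (2 ^ m * K) p) (1 / p) * ennreal C0"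
  have D: "D < \<infinity>"
    using K C1 by (auto simp: D_def epowr_def ennreal_mult_less_top ennreal_mult_eq_top_iff power_eq_top_ennreal)
  show ?thesis
    unfolding multi_bounded_def
  proof (intro exI[of _ "enn2real D"] conjI allI impI)
    fix f assume f: "\<forall>j\<in>{1..m}. in_Lp (q j) (weighted (\<lambda>x. w j x powr q j)) (f j)"
    define g where "g j x = f j x * w j x" for j x
    have fm: "f j \<in> borel_measurable lebesgue" if "j \<in> {1..m}" for j
      using f that by (auto simp: in_Lp_def cong: measurable_cong_sets)
    have norm: "Lp_norm (q j) (weighted (\<lambda>x. w j x powr q j)) (\<lambda>x. ennreal \<bar>f j x\<bar>) =
        Lp_norm (q j) lebesgue (\<lambda>x. ennreal \<bar>g j x\<bar>)" if "j \<in> {1..m}" for j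
      unfolding g_def using assms(2)[OF that] fm[OF that] w[OF that] by (intro Lp_norm_weighted) auto
    have g: "in_Lp (q j) lebesgue (g j)" if "j \<in> {1..m}" for j
    proof -
      have "g j \<in> borel_measurable lebesgue"
        using fm[OF that] w(1)[OF that] unfolding g_def by measurable
      then show ?thesis
        using bspec[OF f that] norm[OF that] by (simp add: in_Lp_def)
    qed
    let ?N = "multi_orlicz_maximal m \<B> (\<lambda>j. complementary (\<Psi> j)) g"
    have "(\<integral>\<^sup>+x. epowr (multi_maximal m \<B> f x) p \<partial>weighted (\<lambda>x. \<nu> x powr p)) \<le>
        ennreal C1 * epowr (2 ^ m * K) p * (\<integral>\<^sup>+x. epowr (?N x) p \<partial>lebesgue)"
      unfolding multi_maximal_def multi_orlicz_maximal_def epowr_SUP[OF p]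
    proof (rule transfer)
      fix B assume B: "B \<in> \<B>"
      show "emeasure (weighted (\<lambda>x. \<nu> x powr p)) B *
            epowr (\<Prod>j=1..m. average B (\<lambda>y. ennreal \<bar>f j y\<bar>)) p \<le>
          epowr (2 ^ m * K) p * (emeasure lebesgue B *
            epowr (\<Prod>j=1..m. luxemburg (complementary (\<Psi> j)) B (\<lambda>y. ennreal \<bar>g j y\<bar>)) p)"
        unfolding g_def
      proof (rule prod_average_le_orlicz[OF p is_basisD(2,3,4)[OF assms(5) B] assms(6) fm w u _ K])
        show "epowr (average B (\<lambda>x. ennreal (\<nu> x powr p))) (1 / p) *
            (\<Prod>j=1..m. luxemburg (\<lambda>t. ennreal (\<Psi> j t)) B (\<lambda>x. inverse (ennreal (w j x)))) \<le> K"
          unfolding K_def using B by (rule SUP_upper)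
      qed
    qed
    then have "Lp_norm p (weighted (\<lambda>x. \<nu> x powr p)) (multi_maximal m \<B> f) \<le>
        epowr (ennreal C1 * epowr (2 ^ m * K) p * (\<integral>\<^sup>+x. epowr (?N x) p \<partial>lebesgue)) (1 / p)"
      unfolding Lp_norm_def using p by (intro epowr_mono) auto
    also have "\<dots> = epowr (ennreal C1 * epowr (2 ^ m * K) p) (1 / p) * Lp_norm p lebesgue ?N"
      using p by (simp add: Lp_norm_def epowr_mult)
    also have "\<dots> \<le> epowr (ennreal C1 * epowr (2 ^ m * K) p) (1 / p) *
        (ennreal C0 * (\<Prod>j=1..m. Lp_norm (q j) lebesgue (\<lambda>x. ennreal \<bar>g j x\<bar>)))"
      by (intro mult_left_mono orlicz g) auto
    also have "\<dots> = ennreal (enn2real D) *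
        (\<Prod>j=1..m. Lp_norm (q j) (weighted (\<lambda>x. w j x powr q j)) (\<lambda>x. ennreal \<bar>f j x\<bar>))"
      using D norm by (simp add: D_def mult.assoc)
    finally show "Lp_norm p (weighted (\<lambda>x. \<nu> x powr p)) (multi_maximal m \<B> f) \<le>
        ennreal (enn2real D) *
        (\<Prod>j=1..m. Lp_norm (q j) (weighted (\<lambda>x. w j x powr q j)) (\<lambda>x. ennreal \<bar>f j x\<bar>))" .
  qed simp
qed

end
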